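(* Let $\widehat{X}$ be a sandpile graph whose sink has no outgoing edges. If $\mathcal{S}(0)=\{\text{sink}\}$, then $G_0=\{0\}$. Otherwise, $G_0$ is equal to the sandpile group of $\mathcal{S}(0)$, viewed as a subgroup of $\mathcal{M}(\widehat{X})$ via the natural inclusion.
   Context: A sandpile graph $\widehat{X}$ is a finite weakly connected directed multigraph (loops and multiple edges allowed) with a distinguished vertex, the sink, reachable by a directed path from every vertex; the set $V$ of non-sink vertices is nonempty, and $X$ is the digraph obtained by deleting the sink (with edge set $E$). A configuration assigns a nonnegative integer number of grains to each non-sink vertex; it is stable if every $v$ holds fewer than $\deg^{+}(v)$ (out-degree) grains. Toppling an unstable vertex sends one grain along each of its out-edges (grains at the sink vanish; the sink never topples); every configuration has a unique stabilization. $\mathcal{M}(\widehat X)$ is the set of stable configurations with $a\oplus b$ = stabilization of $a+b$, a commutative monoid with identity $0$ (the empty configuration); the sandpile group is its minimal ideal (a group, consisting of the recurrent elements, i.e., those accessible from every element, where $a$ is accessible from $b$ if $b\oplus x=a$ for some $x$). For an idempotent $e$, $G_e$ is the unique maximal subgroup of $\mathcal M(\widehat X)$ with identity $e$. The support $\operatorname{supp}(m)$ is the set of vertices holding at least one grain. A cycle is a directed closed path of length $\ge1$ in $X$. For $W\subseteq V$, $\operatorname{cl}(W)$ is the set of $z\in V$ reachable by a directed path (possibly trivial) in $X$ from some $w\in W$. A set $W\subseteq V$ is strongly connected if each of its vertices reaches every other by a path in $X$; a strongly connected component is a maximal such set; it is cyclic if it contains a cycle. A vertex is acyclic if it lies on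 no cycle. For an idempotent $e$, $A(e)$ is the set of acyclic vertices $v\in V$ with $v\notin\operatorname{cl}(\operatorname{supp}(e))$ such that every cyclic strongly connected component reachable from $v$ by a path in $X$ intersects $\operatorname{supp}(e)$. $\mathcal{S}(e)$ is the subgraph of $\widehat X$ induced on $\operatorname{cl}(\operatorname{supp}(e))\cup A(e)\cup\{\text{sink}\}$ (with sink the same sink), whose edges are those of $\widehat X$ with tail in this vertex set. Sandpile configurations on such a subgraph are identified with configurations of $\widehat X$ that vanish outside its non-sink vertices (the natural inclusion), making its sandpile monoid and group subsets of $\mathcal M(\widehat X)$. *)

theory Defs
  imports "HOL-Algebra.Group" "Graph_Theory.Arc_Walk" "Graph_Theory.Digraph_Component"
begin

definition sandpile_graph :: "('v, 'e) pre_digraph \<Rightarrow> 'v \<Rightarrow> bool" where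
  "sandpile_graph G s \<longleftrightarrow>
     fin_digraph G \<and> connected G \<and> s \<in> verts G \<and> verts G - {s} \<noteq> {} \<and>
     (\<forall>v\<in>verts G. v \<rightarrow>\<^sup>*\<^bsub>G\<^esub> s)"

text \<open>A configuration is a function on the whole vertex type that vanishes off the non-sink
  vertices. Hence, for a subgraph with the same sink, the natural inclusion of configurations
  (extension by zero) is the identity on functions.\<close>

definition config :: "('v, 'e) pre_digraph \<Rightarrow> 'v \<Rightarrow> ('v \<Rightarrow> nat) \<Rightarrow> bool" where
  "config G s c \<longleftrightarrow> (\<forall>v. v \<notin> verts G - {s} \<longrightarrow> c v = 0)"

definition stable :: "('v, 'e) pre_digraph \<Rightarrow> 'v \<Rightarrow> ('v \<Rightarrow> nat) \<Rightarrow> bool" where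
  "stable G s c \<longleftrightarrow> config G s c \<and> (\<forall>v\<in>verts G - {s}. c v < out_degree G v)"

definition topple :: "('v, 'e) pre_digraph \<Rightarrow> 'v \<Rightarrow> 'v \<Rightarrow> ('v \<Rightarrow> nat) \<Rightarrow> 'v \<Rightarrow> nat" where
  "topple G s v c = (\<lambda>w. if w \<in> verts G - {s}
     then c w - (if w = v then out_degree G v else 0) + card (out_arcs G v \<inter> in_arcs G w)
     else 0)"

definition topples :: "('v, 'e) pre_digraph \<Rightarrow> 'v \<Rightarrow> ('v \<Rightarrow> nat) \<Rightarrow> ('v \<Rightarrow> nat) \<Rightarrow> bool" where
  "topples G s c c' \<longleftrightarrow> (\<exists>v\<in>verts G - {s}. out_degree G v \<le> c v \<and> c' = topple G s v c)"

definition stabilization :: "('v, 'e) pre_digraph \<Rightarrow> 'v \<Rightarrow> ('v \<Rightarrow> nat) \<Rightarrow> 'v \<Rightarrow> nat" where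
  "stabilization G s c = (THE c'. (topples G s)\<^sup>*\<^sup>* c c' \<and> stable G s c')"

definition sandpile_monoid :: "('v, 'e) pre_digraph \<Rightarrow> 'v \<Rightarrow> ('v \<Rightarrow> nat) monoid" where
  "sandpile_monoid G s =
     \<lparr> carrier = {c. stable G s c},
       monoid.mult = (\<lambda>a b. stabilization G s (\<lambda>v. a v + b v)),
       one = (\<lambda>_. 0) \<rparr>"

definition monoid_ideal :: "('a, 'b) monoid_scheme \<Rightarrow> 'a set \<Rightarrow> bool" where
  "monoid_ideal M I \<longleftrightarrow> I \<noteq> {} \<and> I \<subseteq> carrier M \<and>
     (\<forall>x\<in>I. \<forall>a\<in>carrier M. a \<otimes>\<^bsub>M\<^esub> x \<in> I \<and> x \<otimes>\<^bsub>M\<^esub> a \<in> I)"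

definition minimal_ideal :: "('a, 'b) monoid_scheme \<Rightarrow> 'a set" where
  "minimal_ideal M =
     (THE I. monoid_ideal M I \<and> (\<forall>J. monoid_ideal M J \<and> J \<subseteq> I \<longrightarrow> J = I))"

definition sandpile_group :: "('v, 'e) pre_digraph \<Rightarrow> 'v \<Rightarrow> ('v \<Rightarrow> nat) set" where
  "sandpile_group G s = minimal_ideal (sandpile_monoid G s)"

text \<open>Subgroups of a monoid in the sense of semigroup theory: the identity \<open>e\<close> may be any
  idempotent of \<open>M\<close>.\<close>

definition subgroup_at :: "('a, 'b) monoid_scheme \<Rightarrow> 'a \<Rightarrow> 'a set \<Rightarrow> bool" where
  "subgroup_at M e H \<longleftrightarrow> H \<subseteq> carrier M \<and> group (M\<lparr>carrier := H, one := e\<rparr>)"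

definition maximal_subgroup :: "('a, 'b) monoid_scheme \<Rightarrow> 'a \<Rightarrow> 'a set" where
  "maximal_subgroup M e =
     (THE H. subgroup_at M e H \<and> (\<forall>K. subgroup_at M e K \<and> H \<subseteq> K \<longrightarrow> K = H))"

text \<open>The vertices of a closed walk are exactly the tails of its arcs. A loop is a cycle.\<close>

definition is_cycle :: "('v, 'e) pre_digraph \<Rightarrow> 'e list \<Rightarrow> bool" where
  "is_cycle X p \<longleftrightarrow> p \<noteq> [] \<and> (\<exists>u. pre_digraph.awalk X u p u)"

definition acyclic_vertex :: "('v, 'e) pre_digraph \<Rightarrow> 'v \<Rightarrow> bool" where
  "acyclic_vertex X v \<longleftrightarrow> v \<in> verts X \<and> \<not> (\<exists>p. is_cycle X p \<and> v \<in> tail X ` set p)"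

definition strongly_connected_set :: "('v, 'e) pre_digraph \<Rightarrow> 'v set \<Rightarrow> bool" where
  "strongly_connected_set X W \<longleftrightarrow> W \<subseteq> verts X \<and> (\<forall>u\<in>W. \<forall>v\<in>W. u \<rightarrow>\<^sup>*\<^bsub>X\<^esub> v)"

definition strong_component :: "('v, 'e) pre_digraph \<Rightarrow> 'v set \<Rightarrow> bool" where
  "strong_component X W \<longleftrightarrow> strongly_connected_set X W \<and>
     (\<forall>W'. strongly_connected_set X W' \<and> W \<subseteq> W' \<longrightarrow> W' = W)"

definition cyclic_set :: "('v, 'e) pre_digraph \<Rightarrow> 'v set \<Rightarrow> bool" where
  "cyclic_set X W \<longleftrightarrow> (\<exists>p. is_cycle X p \<and> tail X ` set p \<subseteq> W)"

definition cl :: "('v, 'e) pre_digraph \<Rightarrow> 'v set \<Rightarrow> 'v set" where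
  "cl X W = {z \<in> verts X. \<exists>w\<in>W. w \<rightarrow>\<^sup>*\<^bsub>X\<^esub> z}"

definition supp :: "('v \<Rightarrow> nat) \<Rightarrow> 'v set" where
  "supp m = {v. m v \<ge> 1}"

definition A_set :: "('v, 'e) pre_digraph \<Rightarrow> ('v \<Rightarrow> nat) \<Rightarrow> 'v set" where
  "A_set X e = {v \<in> verts X. acyclic_vertex X v \<and> v \<notin> cl X (supp e) \<and>
     (\<forall>W. strong_component X W \<and> cyclic_set X W \<and> (\<exists>w\<in>W. v \<rightarrow>\<^sup>*\<^bsub>X\<^esub> w) \<longrightarrow> W \<inter> supp e \<noteq> {})}"

definition S_verts :: "('v, 'e) pre_digraph \<Rightarrow> 'v \<Rightarrow> ('v \<Rightarrow> nat) \<Rightarrow> 'v set" where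
  "S_verts G s e =
     (let X = pre_digraph.del_vert G s in cl X (supp e) \<union> A_set X e \<union> {s})"

definition S_graph :: "('v, 'e) pre_digraph \<Rightarrow> 'v \<Rightarrow> ('v \<Rightarrow> nat) \<Rightarrow> ('v, 'e) pre_digraph" where
  "S_graph G s e = G \<restriction> S_verts G s e"

text \<open>If the sink has no outgoing edges, the heads of the edges leaving the vertex set lie in it
  again, so the induced subgraph keeps every edge with tail in the set, and stabilization in the
  subgraph agrees with stabilization in the whole graph.\<close>

lemma S_verts_closed:
  assumes wf: "wf_digraph G" and sink: "out_arcs G s = {}"
    and a: "a \<in> arcs G" "tail G a \<in> S_verts G s e"
  shows "head G a \<in> S_verts G s e"
proof (cases "head G a = s")
  case True
  then show ?thesis by (simp add: S_verts_def Let_def)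
next
  case False
  interpret G: wf_digraph G by (fact wf)
  define X where "X = pre_digraph.del_vert G s"
  interpret X: wf_digraph X unfolding X_def by (rule G.wf_digraph_del_vert)
  let ?t = "tail G a" and ?h = "head G a"
  have t: "?t \<noteq> s" using sink a by (auto simp: out_arcs_def)
  have aX: "a \<in> arcs X" "tail X a = ?t" "head X a = ?h"
    using a t False by (auto simp: X_def G.del_vert_simps)
  then have th: "?t \<rightarrow>\<^bsub>X\<^esub> ?h" by (metis X.dominatesI arc_to_ends_def)
  have hX: "?h \<in> verts X" using th X.adj_in_verts by blast
  have "?t \<in> cl X (supp e) \<union> A_set X e" using a t by (simp add: S_verts_def X_def Let_def)
  then have "?h \<in> cl X (supp e) \<union> A_set X e"
  proof
    assume "?t \<in> cl X (supp e)"
    then show ?thesis using th hX by (auto simp: cl_def intro: X.reachable_adj_trans)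
  next
    assume A: "?t \<in> A_set X e"
    have reach: "W \<inter> supp e \<noteq> {}"
      if "strong_component X W" "cyclic_set X W" "w \<in> W" "?h \<rightarrow>\<^sup>*\<^bsub>X\<^esub> w" for W w
      using A that th X.adj_reachable_trans[of ?t ?h w] unfolding A_set_def by blast
    show ?thesis
    proof (cases "acyclic_vertex X ?h")
      case True
      then show ?thesis using reach hX by (auto simp: A_set_def)
    next
      case False
      then obtain p where p: "is_cycle X p" "?h \<in> tail X ` set p"
        using hX by (auto simp: acyclic_vertex_def)
      then obtain u where u: "X.awalk u p u" by (auto simp: is_cycle_def)
      define W where "W = {v. ?h \<rightarrow>\<^sup>*\<^bsub>X\<^esub> v \<and> v \<rightarrow>\<^sup>*\<^bsub>X\<^esub> ?h}"
      have hW: "?h \<in> W" using hX by (simp add: W_def)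
      have "strongly_connected_set X W"
        unfolding strongly_connected_set_def W_def
        using X.reachable_trans X.reachable_in_verts(2) by blast
      moreover have "W' = W" if "strongly_connected_set X W'" "W \<subseteq> W'" for W'
        using that hW unfolding strongly_connected_set_def W_def by blast
      ultimately have "strong_component X W" unfolding strong_component_def by blast
      moreover have "cyclic_set X W"
      proof -
        have vs: "w \<in> set (X.awalk_verts u p)" if "w \<in> tail X ` set p" for w
          using that by (auto simp: X.awalk_verts_conv)
        have "w \<rightarrow>\<^sup>*\<^bsub>X\<^esub> w'" if "w \<in> tail X ` set p" "w' \<in> tail X ` set p" for w w'
          using X.awalk_verts_reachable_to[OF u vs[OF that(1)]]
            X.awalk_verts_reachable_from[OF u vs[OF that(2)]] X.reachable_trans by blast
        then have "tail X ` set p \<subseteq> W" using p(2) unfolding W_def by blast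
        then show ?thesis using p(1) unfolding cyclic_set_def by blast
      qed
      ultimately obtain v where v: "v \<in> W" "v \<in> supp e" using reach hW W_def by blast
      then show ?thesis using hX by (auto simp: cl_def W_def)
    qed
  qed
  then show ?thesis by (simp add: S_verts_def X_def Let_def)
qed

lemma arcs_S_graph:
  assumes "wf_digraph G" "out_arcs G s = {}"
  shows "arcs (S_graph G s e) = {a \<in> arcs G. tail G a \<in> S_verts G s e}"
  using S_verts_closed[OF assms] by (auto simp: S_graph_def)

lemma S_verts_subset: "s \<in> verts G \<Longrightarrow> S_verts G s e \<subseteq> verts G"
  by (auto simp: S_verts_def Let_def cl_def A_set_def pre_digraph.del_vert_def)

lemma config_topple: "config G s (topple G s v c)"
  by (auto simp: config_def topple_def)

lemma out_degree_pos:
  assumes "sandpile_graph G s" "v \<in> verts G - {s}"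
  shows "0 < out_degree G v"
proof -
  interpret fin_digraph G using assms by (simp add: sandpile_graph_def)
  have "v \<rightarrow>\<^sup>*\<^bsub>G\<^esub> s" "v \<noteq> s" using assms by (auto simp: sandpile_graph_def)
  then obtain w where "v \<rightarrow>\<^bsub>G\<^esub> w" by (blast elim: converse_reachable_cases)
  then obtain a where "a \<in> out_arcs G v" by auto
  then show ?thesis unfolding out_degree_def using finite_out_arcs by (auto simp: card_gt_0_iff)
qed

lemma stabilization_S_graph:
  assumes G: "sandpile_graph G s" and sink: "out_arcs G s = {}" and c: "config (S_graph G s e) s c"
  shows "stabilization (S_graph G s e) s c = stabilization G s c"
proof -
  interpret fin_digraph G using G by (simp add: sandpile_graph_def)
  let ?S = "S_graph G s e"
  have sG: "s \<in> verts G" using G by (simp add: sandpile_graph_def)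
  have vS: "verts ?S \<subseteq> verts G" using S_verts_subset[OF sG] by (simp add: S_graph_def)
  have th: "tail ?S = tail G" "head ?S = head G" by (simp_all add: S_graph_def)
  have arcs: "arcs ?S = {a \<in> arcs G. tail G a \<in> verts ?S}"
    using arcs_S_graph[OF wf_digraph sink] by (simp add: S_graph_def)
  have closed: "head G a \<in> verts ?S" if "a \<in> arcs G" "tail G a \<in> verts ?S" for a
    using S_verts_closed[OF wf_digraph sink] that by (simp add: S_graph_def)
  have out: "out_arcs ?S v = out_arcs G v" if "v \<in> verts ?S" for v
    using that th arcs by (auto simp: out_arcs_def)
  have deg: "out_degree ?S v = out_degree G v" if "v \<in> verts ?S" for v
    using out[OF that] by (simp add: out_degree_def)
  have btw: "out_arcs ?S v \<inter> in_arcs ?S w = out_arcs G v \<inter> in_arcs G w" if "v \<in> verts ?S" for v w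
    using that th arcs by (auto simp: out_arcs_def in_arcs_def)
  have top: "topple ?S s v d = topple G s v d" if "v \<in> verts ?S" "config ?S s d" for v d
  proof
    fix w
    show "topple ?S s v d w = topple G s v d w"
    proof (cases "w \<in> verts ?S - {s}")
      case True
      then show ?thesis using vS that(1) deg btw by (auto simp: topple_def)
    next
      case False
      have "out_arcs G v \<inter> in_arcs G w = {}" if "w \<noteq> s"
        using False that closed \<open>v \<in> verts ?S\<close> by auto
      then show ?thesis using False that by (auto simp: topple_def config_def)
    qed
  qed
  have eq: "topples ?S s d d' \<longleftrightarrow> topples G s d d'" if d: "config ?S s d" for d d'
  proof
    assume "topples ?S s d d'"
    then obtain v where v: "v \<in> verts ?S - {s}" "out_degree ?S v \<le> d v" "d' = topple ?S s v d"
      by (auto simp: topples_def)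
    then have "v \<in> verts G - {s}" "out_degree G v \<le> d v" "d' = topple G s v d"
      using vS deg top d by auto
    then show "topples G s d d'" unfolding topples_def by blast
  next
    assume "topples G s d d'"
    then obtain v where v: "v \<in> verts G - {s}" "out_degree G v \<le> d v" "d' = topple G s v d"
      by (auto simp: topples_def)
    then have "d v \<noteq> 0" using out_degree_pos[OF G v(1)] by simp
    then have vs: "v \<in> verts ?S - {s}" using d unfolding config_def by metis
    then have "out_degree ?S v \<le> d v" "d' = topple ?S s v d" using v deg top d by auto
    with vs show "topples ?S s d d'" unfolding topples_def by blast
  qed
  have conf: "config ?S s d'" if "topples ?S s d d'" for d d'
    using that by (auto simp: topples_def config_topple)
  have steps1: "(topples G s)\<^sup>*\<^sup>* c d \<and> config ?S s d" if "(topples ?S s)\<^sup>*\<^sup>* c d" for d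
    using that
  proof induction
    case base
    then show ?case using c by simp
  next
    case (step d d')
    then show ?case using eq[of d d'] conf[of d d'] by (auto intro: rtranclp.rtrancl_into_rtrancl)
  qed
  have steps2: "(topples ?S s)\<^sup>*\<^sup>* c d \<and> config ?S s d" if "(topples G s)\<^sup>*\<^sup>* c d" for d
    using that
  proof induction
    case base
    then show ?case using c by simp
  next
    case (step d d')
    then show ?case using eq[of d d'] conf[of d d'] by (auto intro: rtranclp.rtrancl_into_rtrancl)
  qed
  have stab: "stable ?S s d \<longleftrightarrow> stable G s d" if "config ?S s d" for d
  proof -
    have confG: "config G s d" using that vS by (auto simp: config_def)
    have outside: "d v < out_degree G v" if "v \<in> verts G - {s}" "v \<notin> verts ?S" for v
      using out_degree_pos[OF G that(1)] \<open>config ?S s d\<close> that by (simp add: config_def)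
    have "(\<forall>v\<in>verts ?S - {s}. d v < out_degree ?S v) \<longleftrightarrow>
        (\<forall>v\<in>verts G - {s}. d v < out_degree G v)" (is "?l \<longleftrightarrow> ?r")
    proof
      assume l: ?l
      show ?r
      proof
        fix v assume v: "v \<in> verts G - {s}"
        show "d v < out_degree G v"
        proof (cases "v \<in> verts ?S")
          case True
          then have "d v < out_degree ?S v" using l v by blast
          then show ?thesis using deg[OF True] by simp
        qed (rule outside[OF v])
      qed
    next
      assume r: ?r
      show ?l
      proof
        fix v assume "v \<in> verts ?S - {s}"
        then show "d v < out_degree ?S v" using r vS deg[of v] by auto
      qed
    qed
    then show ?thesis using that confG by (simp add: stable_def)
  qed
  have "((topples ?S s)\<^sup>*\<^sup>* c d \<and> stable ?S s d) = ((topples G s)\<^sup>*\<^sup>* c d \<and> stable G s d)" for d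
    using steps1[of d] steps2[of d] stab[of d] by auto
  then show ?thesis by (simp add: stabilization_def)
qed

end

theory Submission
  imports Defs "HOL-Library.Confluence" "HOL-Algebra.Divisibility"
begin

text \<open>
  The group \<open>G\<^sub>0\<close> consists of the units of the sandpile monoid, and a non-sink vertex lies in
  \<open>\<S>(0)\<close> iff it reaches no cycle. A vertex that does reach a cycle has an out-neighbour of the
  same kind, so toppling never clears the set of these vertices: a unit cannot charge any of them.
  Conversely, let \<open>v\<close> be a vertex of \<open>\<S>(0)\<close>. Toppling \<open>deg\<^sup>+(v)\<close> grains at \<open>v\<close> leaves grains on
  out-neighbours of \<open>v\<close> only, which are units by well-founded induction; so a single grain at \<open>v\<close>
  divides a unit and is one itself. Hence the units are exactly the stable configurations of
  \<open>\<S>(0)\<close>; these form a group, and a group is its own minimal ideal.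
\<close>

section \<open>Units, subgroups and ideals of monoids\<close>

lemma (in monoid) maximal_subgroup_one: "maximal_subgroup G \<one> = Units G"
  unfolding maximal_subgroup_def
proof (rule the_equality)
  have "group (G\<lparr>carrier := Units G, one := \<one>\<rparr>)"
    by (rule groupI) (auto simp: m_assoc Units_closed intro: Units_l_inv)
  then have subgroup_Units: "subgroup_at G \<one> (Units G)"
    by (auto simp: subgroup_at_def)
  have subset_Units: "K \<subseteq> Units G" if subgroup_K: "subgroup_at G \<one> K" for K
  proof
    fix x assume "x \<in> K"
    interpret K: group "G\<lparr>carrier := K, one := \<one>\<rparr>"
      using subgroup_K by (simp add: subgroup_at_def)
    obtain y where "y \<in> K" "x \<otimes> y = \<one>" "y \<otimes> x = \<one>"
      using K.Units_eq \<open>x \<in> K\<close> by (auto simp: Units_def)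
    then show "x \<in> Units G"
      using subgroup_K \<open>x \<in> K\<close> by (auto simp: Units_def subgroup_at_def)
  qed
  show "subgroup_at G \<one> (Units G) \<and> (\<forall>K. subgroup_at G \<one> K \<and> Units G \<subseteq> K \<longrightarrow> K = Units G)"
    using subgroup_Units subset_Units by blast
  show "H = Units G"
    if "subgroup_at G \<one> H \<and> (\<forall>K. subgroup_at G \<one> K \<and> H \<subseteq> K \<longrightarrow> K = H)" for H
    using that subgroup_Units subset_Units by blast
qed

lemma (in group) monoid_ideal_iff: "monoid_ideal G I \<longleftrightarrow> I = carrier G"
proof
  assume ideal: "monoid_ideal G I"
  then obtain x where x_in: "x \<in> I" "x \<in> carrier G" by (auto simp: monoid_ideal_def)
  have "a \<in> I" if "a \<in> carrier G" for a
  proof -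
    have "(a \<otimes> inv x) \<otimes> x \<in> I" using ideal x_in that by (simp add: monoid_ideal_def)
    then show ?thesis using x_in that by (simp add: m_assoc)
  qed
  then show "I = carrier G" using ideal by (auto simp: monoid_ideal_def)
qed (auto simp: monoid_ideal_def)

lemma (in group) minimal_ideal_eq_carrier: "minimal_ideal G = carrier G"
  unfolding minimal_ideal_def monoid_ideal_iff by (rule the_equality) auto

section \<open>Cycles and strong components\<close>

context wf_digraph
begin

lemma ex_cycle_through_iff: "(\<exists>p. is_cycle G p \<and> v \<in> tail G ` set p) \<longleftrightarrow> v \<rightarrow>\<^sup>+ v"
proof
  assume "\<exists>p. is_cycle G p \<and> v \<in> tail G ` set p"
  then obtain p u a where closed: "awalk u p u" and a_in_p: "a \<in> set p" "v = tail G a"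
    by (auto simp: is_cycle_def)
  then obtain q r where "p = q @ a # r" by (auto simp: in_set_conv_decomp)
  then have "awalk v (a # r) u" "awalk u q v" using closed a_in_p by (auto simp: awalk_Cons_iff)
  then have "awalk v ((a # r) @ q) v" by (rule awalk_appendI)
  then show "v \<rightarrow>\<^sup>+ v" by (rule reachable1_awalkI) simp
next
  assume "v \<rightarrow>\<^sup>+ v"
  then obtain p where closed: "awalk v p v" "p \<noteq> []" unfolding reachable1_awalk by blast
  then have "v = tail G (hd p)" by (cases p) (auto simp: awalk_Cons_iff)
  then show "\<exists>p. is_cycle G p \<and> v \<in> tail G ` set p" using closed by (auto simp: is_cycle_def)
qed

lemma acyclic_vertex_iff: "acyclic_vertex G v \<longleftrightarrow> v \<in> verts G \<and> \<not> v \<rightarrow>\<^sup>+ v"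
  unfolding acyclic_vertex_def ex_cycle_through_iff ..

lemma cycle_tails_subset_scc_of:
  assumes "is_cycle G p" "v \<in> tail G ` set p"
  shows "tail G ` set p \<subseteq> scc_of v"
proof -
  obtain u where closed: "awalk u p u" using assms(1) by (auto simp: is_cycle_def)
  have "x \<rightarrow>\<^sup>* u \<and> u \<rightarrow>\<^sup>* x" if "x \<in> tail G ` set p" for x
  proof -
    have "x \<in> set (awalk_verts u p)" using that by (auto simp: awalk_verts_conv)
    then show ?thesis
      using awalk_verts_reachable_to[OF closed] awalk_verts_reachable_from[OF closed] by simp
  qed
  then show ?thesis using assms(2) unfolding scc_of_def by (blast intro: reachable_trans)
qed

lemma strong_component_scc_of:
  assumes "v \<in> verts G"
  shows "strong_component G (scc_of v)"
proof -
  have "strongly_connected_set G (scc_of v)"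
    unfolding strongly_connected_set_def scc_of_def
    using reachable_trans reachable_in_verts(2) by blast
  moreover have "W = scc_of v" if "strongly_connected_set G W" "scc_of v \<subseteq> W" for W
    using that in_scc_of_self[OF assms] unfolding strongly_connected_set_def scc_of_def by blast
  ultimately show ?thesis unfolding strong_component_def by blast
qed

lemma strong_component_eq_scc_of:
  assumes "strong_component G W" "v \<in> W"
  shows "W = scc_of v"
proof -
  have "v \<in> verts G" "W \<subseteq> scc_of v"
    using assms by (auto simp: strong_component_def strongly_connected_set_def scc_of_def)
  then show ?thesis
    using assms(1) strong_component_scc_of unfolding strong_component_def by blast
qed

lemma cyclic_strong_component_iff:
  "strong_component G W \<and> cyclic_set G W \<longleftrightarrow> (\<exists>v. v \<rightarrow>\<^sup>+ v \<and> W = scc_of v)"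
proof (intro iffI; elim conjE exE)
  assume component: "strong_component G W" and "cyclic_set G W"
  then obtain p where cycle: "is_cycle G p" and tails: "tail G ` set p \<subseteq> W"
    by (auto simp: cyclic_set_def)
  define v where "v = tail G (hd p)"
  have v_in: "v \<in> tail G ` set p" using cycle by (simp add: v_def is_cycle_def)
  then have "v \<rightarrow>\<^sup>+ v" using cycle ex_cycle_through_iff by metis
  moreover have "W = scc_of v"
    using strong_component_eq_scc_of component tails v_in by (metis subsetD)
  ultimately show "\<exists>v. v \<rightarrow>\<^sup>+ v \<and> W = scc_of v" by blast
next
  fix v assume v_cyclic: "v \<rightarrow>\<^sup>+ v" and W_eq: "W = scc_of v"
  then obtain p where "is_cycle G p" "v \<in> tail G ` set p" using ex_cycle_through_iff by metis
  then have "cyclic_set G W"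
    using cycle_tails_subset_scc_of W_eq unfolding cyclic_set_def by blast
  moreover have "strong_component G W"
    using v_cyclic W_eq strong_component_scc_of reachable1_in_verts(1) by simp
  ultimately show "strong_component G W \<and> cyclic_set G W" by simp
qed

lemma A_set_altdef:
  "A_set G e = {v \<in> verts G. \<not> v \<rightarrow>\<^sup>+ v \<and> v \<notin> cl G (supp e) \<and>
    (\<forall>x. v \<rightarrow>\<^sup>* x \<and> x \<rightarrow>\<^sup>+ x \<longrightarrow> scc_of x \<inter> supp e \<noteq> {})}"
proof -
  have reaches_iff: "(\<exists>w\<in>scc_of x. v \<rightarrow>\<^sup>* w) \<longleftrightarrow> v \<rightarrow>\<^sup>* x" if "x \<rightarrow>\<^sup>+ x" for v x
  proof
    assume "\<exists>w\<in>scc_of x. v \<rightarrow>\<^sup>* w"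
    then obtain w where "v \<rightarrow>\<^sup>* w" "w \<rightarrow>\<^sup>* x" by (auto simp: scc_of_def)
    then show "v \<rightarrow>\<^sup>* x" by (rule reachable_trans)
  next
    assume "v \<rightarrow>\<^sup>* x"
    then show "\<exists>w\<in>scc_of x. v \<rightarrow>\<^sup>* w"
      using in_scc_of_self reachable1_in_verts(1)[OF that] by blast
  qed
  have "(\<forall>W. strong_component G W \<and> cyclic_set G W \<and> (\<exists>w\<in>W. v \<rightarrow>\<^sup>* w) \<longrightarrow>
        W \<inter> supp e \<noteq> {}) \<longleftrightarrow>
      (\<forall>x. x \<rightarrow>\<^sup>+ x \<and> (\<exists>w\<in>scc_of x. v \<rightarrow>\<^sup>* w) \<longrightarrow> scc_of x \<inter> supp e \<noteq> {})" for v
    using cyclic_strong_component_iff by metis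
  moreover have "(x \<rightarrow>\<^sup>+ x \<and> (\<exists>w\<in>scc_of x. v \<rightarrow>\<^sup>* w)) \<longleftrightarrow> v \<rightarrow>\<^sup>* x \<and> x \<rightarrow>\<^sup>+ x" for v x
    using reaches_iff by metis
  ultimately show ?thesis unfolding A_set_def acyclic_vertex_iff by simp
qed

lemma A_set_zero: "A_set G (\<lambda>_. 0) = {v \<in> verts G. \<forall>x. v \<rightarrow>\<^sup>* x \<longrightarrow> \<not> x \<rightarrow>\<^sup>+ x}"
  by (auto simp: A_set_altdef cl_def supp_def)

lemma dominates_del_vert: "v \<rightarrow>\<^bsub>del_vert u\<^esub> w \<longleftrightarrow> v \<rightarrow>\<^bsub>G\<^esub> w \<and> v \<noteq> u \<and> w \<noteq> u"
  by (auto simp: arcs_ends_conv del_vert_simps)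

end

context fin_digraph
begin

lemma wf_successors_of_acyclic: "wf {(w, v). v \<rightarrow>\<^bsub>G\<^esub> w \<and> \<not> v \<rightarrow>\<^sup>+ v}" (is "wf ?R")
proof (rule finite_acyclic_wf)
  show "finite ?R"
    by (rule finite_subset[of _ "verts G \<times> verts G"]) (auto dest: adj_in_verts)
  show "acyclic ?R"
  proof (rule acyclicI, intro allI notI)
    fix v assume v_loop: "(v, v) \<in> ?R\<^sup>+"
    have "?R \<subseteq> (arcs_ends G)\<inverse>" by auto
    then have "(v, v) \<in> ((arcs_ends G)\<inverse>)\<^sup>+" using v_loop trancl_mono by blast
    then have "v \<rightarrow>\<^sup>+ v" by (simp add: trancl_converse)
    moreover have "\<not> v \<rightarrow>\<^sup>+ v" using v_loop by (auto dest: tranclD2)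
    ultimately show False by contradiction
  qed
qed

lemma out_degree_le_card_arcs: "out_degree G v \<le> card (arcs G)"
  unfolding out_degree_def by (rule card_mono) auto

lemma card_arcs_between_pos_iff: "0 < card (out_arcs G v \<inter> in_arcs G w) \<longleftrightarrow> v \<rightarrow>\<^bsub>G\<^esub> w"
  by (auto simp: card_gt_0_iff arcs_ends_conv)

end

section \<open>Stabilization\<close>

definition grain :: "'v \<Rightarrow> 'v \<Rightarrow> nat" where
  "grain v = (\<lambda>w. if w = v then 1 else 0)"

locale sandpile =
  fixes G :: "('v, 'e) pre_digraph" (structure) and s :: 'v
  assumes sandpile_graph: "sandpile_graph G s"
begin

sublocale fin_digraph G
  using sandpile_graph by (simp add: sandpile_graph_def)

abbreviation V :: "'v set" where
  "V \<equiv> verts G - {s}"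

abbreviation stab :: "('v \<Rightarrow> nat) \<Rightarrow> 'v \<Rightarrow> nat" where
  "stab \<equiv> stabilization G s"

abbreviation M :: "('v \<Rightarrow> nat) monoid" where
  "M \<equiv> sandpile_monoid G s"

lemmas out_degree_pos = Defs.out_degree_pos[OF sandpile_graph]

lemma config_add: "config G s c \<Longrightarrow> config G s d \<Longrightarrow> config G s (\<lambda>v. c v + d v)"
  by (simp add: config_def)

lemma stable_imp_config: "stable G s c \<Longrightarrow> config G s c"
  by (simp add: stable_def)

lemma stable_zero: "stable G s (\<lambda>_. 0)"
  using out_degree_pos by (simp add: stable_def config_def)

lemma stable_iff_not_topples: "stable G s c \<longleftrightarrow> config G s c \<and> (\<nexists>d. topples G s c d)"
  by (auto simp: stable_def topples_def not_le)

lemma topples_imp_config: "topples G s c d \<Longrightarrow> config G s d"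
  by (auto simp: topples_def config_topple)

lemma topples_rtranclp_config: "(topples G s)\<^sup>*\<^sup>* c d \<Longrightarrow> config G s c \<Longrightarrow> config G s d"
  by (erule rtranclp.cases) (auto dest: topples_imp_config)

lemma topples_rtranclp_stable: "(topples G s)\<^sup>*\<^sup>* c d \<Longrightarrow> stable G s c \<Longrightarrow> d = c"
  by (erule converse_rtranclpE) (auto simp: stable_iff_not_topples)

lemma topples_add:
  assumes "topples G s c c'" "config G s d"
  shows "topples G s (\<lambda>v. c v + d v) (\<lambda>v. c' v + d v)"
proof -
  obtain v where unstable: "v \<in> V" "out_degree G v \<le> c v" and "c' = topple G s v c"
    using assms(1) by (auto simp: topples_def)
  then have "(\<lambda>w. c' w + d w) = topple G s v (\<lambda>w. c w + d w)"
    using assms(2) by (auto simp: fun_eq_iff topple_def config_def)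
  then show ?thesis using unstable unfolding topples_def by (intro bexI[of _ v]) auto
qed

lemma topples_rtranclp_add:
  assumes "(topples G s)\<^sup>*\<^sup>* c c'" "config G s d"
  shows "(topples G s)\<^sup>*\<^sup>* (\<lambda>v. c v + d v) (\<lambda>v. c' v + d v)"
  using assms(1)
  by induction (auto intro: rtranclp.rtrancl_into_rtrancl topples_add[OF _ assms(2)])

lemma strong_confluentp_topples: "strong_confluentp (topples G s)"
proof
  fix c c1 c2
  assume "topples G s c c1" "topples G s c c2"
  then obtain v w where
    v_unstable: "v \<in> V" "out_degree G v \<le> c v" and c1: "c1 = topple G s v c" and
    w_unstable: "w \<in> V" "out_degree G w \<le> c w" and c2: "c2 = topple G s w c"
    by (auto simp: topples_def)
  show "\<exists>d. (topples G s)\<^sup>*\<^sup>* c1 d \<and> (topples G s)\<^sup>=\<^sup>= c2 d"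
  proof (cases "v = w")
    case True
    then show ?thesis using c1 c2 by auto
  next
    case False
    have "topple G s w c1 = topple G s v c2"
      using False v_unstable w_unstable by (auto simp: c1 c2 fun_eq_iff topple_def)
    moreover have "out_degree G w \<le> c1 w" "out_degree G v \<le> c2 v"
      using False v_unstable w_unstable by (auto simp: c1 c2 topple_def)
    ultimately have "topples G s c1 (topple G s w c1)" "topples G s c2 (topple G s w c1)"
      using v_unstable(1) w_unstable(1) unfolding topples_def by auto
    then show ?thesis by blast
  qed
qed

lemma sum_topple:
  fixes h :: "'v \<Rightarrow> 'a::comm_ring_1"
  assumes "h s = 0" and unstable: "v \<in> V" "out_degree G v \<le> c v"
  shows "(\<Sum>w\<in>V. h w * of_nat (topple G s v c w)) =
    (\<Sum>w\<in>V. h w * of_nat (c w)) - h v * of_nat (out_degree G v) +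
    (\<Sum>a\<in>out_arcs G v. h (head G a))"
proof -
  let ?k = "\<lambda>w. card (out_arcs G v \<inter> in_arcs G w)"
  have topple_eq: "h w * of_nat (topple G s v c w) = h w * of_nat (c w) -
      (if w = v then h v * of_nat (out_degree G v) else 0) + h w * of_nat (?k w)"
    if "w \<in> V" for w
    using that unstable(2) by (auto simp: topple_def algebra_simps)
  have arcs_to: "{a \<in> out_arcs G v. head G a = w} = out_arcs G v \<inter> in_arcs G w" for w
    by auto
  have "(\<Sum>w\<in>V. h w * of_nat (?k w)) = (\<Sum>w\<in>verts G. h w * of_nat (?k w))"
    by (rule sum.mono_neutral_left) (use \<open>h s = 0\<close> in auto)
  also have "\<dots> = (\<Sum>w\<in>verts G. \<Sum>a\<in>{a \<in> out_arcs G v. head G a = w}. h (head G a))"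
    by (rule sum.cong) (auto simp: mult.commute simp flip: arcs_to)
  also have "\<dots> = (\<Sum>a\<in>out_arcs G v. h (head G a))"
    by (rule sum.group) auto
  finally show ?thesis
    using unstable(1) by (simp add: topple_eq sum.distrib sum_subtractf)
qed

definition sink_dist :: "'v \<Rightarrow> nat" where
  "sink_dist v = (LEAST n. (v, s) \<in> arcs_ends G ^^ n)"

lemma sink_dist_sink: "sink_dist s = 0"
  by (simp add: sink_dist_def)

lemma ex_arc_towards_sink:
  assumes "v \<in> V"
  shows "\<exists>a\<in>out_arcs G v. sink_dist (head G a) < sink_dist v"
proof -
  have "v \<rightarrow>\<^sup>* s" using assms sandpile_graph by (auto simp: sandpile_graph_def)
  then have "\<exists>n. (v, s) \<in> arcs_ends G ^^ n"
    using reachable_rtranclI rtrancl_imp_relpow by metis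
  then have path: "(v, s) \<in> arcs_ends G ^^ sink_dist v"
    unfolding sink_dist_def by (rule LeastI_ex)
  moreover have "sink_dist v \<noteq> 0" using path assms by (metis Diff_iff insertI1 relpow_0_E)
  ultimately obtain n w where dist_v: "sink_dist v = Suc n" and
    "v \<rightarrow>\<^bsub>G\<^esub> w" and path_w: "(w, s) \<in> arcs_ends G ^^ n"
    by (metis not0_implies_Suc relpow_Suc_E2)
  then obtain a where a_out: "a \<in> out_arcs G v" and head_a: "head G a = w" by auto
  have "sink_dist w \<le> n" unfolding sink_dist_def by (rule Least_le) (fact path_w)
  then have "sink_dist (head G a) < sink_dist v" using head_a dist_v by simp
  then show ?thesis using a_out by blast
qed

text \<open>
  Take \<open>h v = K\<^sup>D - K\<^bsup>D - sink_dist v\<^esup>\<close>, where \<open>D\<close> is the largest distance to the sink and \<open>K\<close>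
  exceeds all out-degrees: the power of \<open>K\<close> at an out-neighbour of \<open>v\<close> closer to the sink than
  \<open>v\<close> already exceeds \<open>deg\<^sup>+(v)\<close> times the power at \<open>v\<close>.
\<close>

lemma ex_superharmonic:
  obtains h :: "'v \<Rightarrow> int" where "h s = 0" "\<And>v. 0 \<le> h v"
    "\<And>v. v \<in> V \<Longrightarrow> (\<Sum>a\<in>out_arcs G v. h (head G a)) < h v * int (out_degree G v)"
proof -
  define D where "D = Max (sink_dist ` verts G)"
  define K where "K = int (card (arcs G)) + 1"
  define g where "g v = K ^ (D - sink_dist v)" for v
  have K_ge_1: "1 \<le> K" and degree_less_K: "int (out_degree G v) < K" for v
    using out_degree_le_card_arcs[of v] by (simp_all add: K_def)
  have g_pos: "0 < g v" for v using K_ge_1 by (simp add: g_def)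
  have g_increases: "g v * int (out_degree G v) < (\<Sum>a\<in>out_arcs G v. g (head G a))"
    if "v \<in> V" for v
  proof -
    obtain a where a_out: "a \<in> out_arcs G v" and closer: "sink_dist (head G a) < sink_dist v"
      using ex_arc_towards_sink[OF \<open>v \<in> V\<close>] by blast
    have "sink_dist v \<le> D" using \<open>v \<in> V\<close> by (simp add: D_def)
    then have exponents: "Suc (D - sink_dist v) \<le> D - sink_dist (head G a)" using closer by simp
    have "g v * int (out_degree G v) < g v * K" using g_pos degree_less_K by simp
    also have "\<dots> \<le> g (head G a)"
      using power_increasing[OF exponents K_ge_1] by (simp add: g_def mult.commute)
    also have "\<dots> \<le> (\<Sum>a\<in>out_arcs G v. g (head G a))"
      using member_le_sum[OF a_out, of "\<lambda>a. g (head G a)"] less_imp_le[OF g_pos] finite_out_arcs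
      by simp
    finally show ?thesis .
  qed
  show thesis
  proof
    show "K ^ D - g s = 0" by (simp add: g_def sink_dist_sink)
    show "0 \<le> K ^ D - g v" for v using K_ge_1 by (simp add: g_def power_increasing)
    show "(\<Sum>a\<in>out_arcs G v. K ^ D - g (head G a)) < (K ^ D - g v) * int (out_degree G v)"
      if "v \<in> V" for v
      using g_increases[OF that] by (simp add: sum_subtractf out_degree_def algebra_simps)
  qed
qed

lemma wfp_topples: "wfp (topples G s)\<inverse>\<inverse>"
proof -
  obtain h :: "'v \<Rightarrow> int" where h_sink: "h s = 0" and h_nonneg: "\<And>v. 0 \<le> h v" and
    h_superharmonic:
      "\<And>v. v \<in> V \<Longrightarrow> (\<Sum>a\<in>out_arcs G v. h (head G a)) < h v * int (out_degree G v)"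
    using ex_superharmonic by blast
  define f where "f c = (\<Sum>w\<in>V. h w * int (c w))" for c
  have f_nonneg: "0 \<le> f c" for c using h_nonneg by (auto simp: f_def intro!: sum_nonneg)
  have f_decreases: "f d < f c" if topples: "topples G s c d" for c d
  proof -
    obtain v where "v \<in> V" "out_degree G v \<le> c v" "d = topple G s v c"
      using topples by (auto simp: topples_def)
    then show ?thesis using sum_topple[of h v c] h_sink h_superharmonic[of v] by (simp add: f_def)
  qed
  show ?thesis
  proof (rule wfp_if_convertible_to_nat)
    show "nat (f d) < nat (f c)" if "(topples G s)\<inverse>\<inverse> d c" for c d
      using that f_decreases[of c d] f_nonneg[of d] by simp
  qed
qed

lemma stabilization_eqI:
  assumes "(topples G s)\<^sup>*\<^sup>* c d" "stable G s d"
  shows "stab c = d"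
  unfolding stabilization_def
proof (rule the_equality)
  have confluent: "confluentp (topples G s)"
    by (rule strong_confluentp_imp_confluentp[OF strong_confluentp_topples])
  show "d' = d" if "(topples G s)\<^sup>*\<^sup>* c d' \<and> stable G s d'" for d'
    using confluentpD[OF confluent assms(1)] that assms(2) topples_rtranclp_stable by metis
qed (use assms in simp)

lemma
  assumes "config G s c"
  shows topples_stabilization: "(topples G s)\<^sup>*\<^sup>* c (stab c)"
    and stable_stabilization: "stable G s (stab c)"
proof -
  obtain d where reduces: "(topples G s)\<^sup>*\<^sup>* c d" and "\<nexists>d'. topples G s d d'"
    using ex_terminating_rtranclp[OF wfp_topples] by blast
  then have "stable G s d"
    using topples_rtranclp_config assms by (simp add: stable_iff_not_topples)
  then show "(topples G s)\<^sup>*\<^sup>* c (stab c)" "stable G s (stab c)"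
    using reduces stabilization_eqI by simp_all
qed

lemma stabilization_stable: "stable G s c \<Longrightarrow> stab c = c"
  by (rule stabilization_eqI) auto

lemma stabilization_topples_rtranclp:
  assumes "config G s c" "(topples G s)\<^sup>*\<^sup>* c d"
  shows "stab d = stab c"
proof -
  have "config G s d" by (rule topples_rtranclp_config[OF assms(2,1)])
  then have "(topples G s)\<^sup>*\<^sup>* c (stab d)" "stable G s (stab d)"
    using assms(2) topples_stabilization stable_stabilization by (blast intro: rtranclp_trans)+
  then show ?thesis by (rule stabilization_eqI[symmetric])
qed

lemma stabilization_add_left:
  assumes "config G s c" "config G s d"
  shows "stab (\<lambda>v. stab c v + d v) = stab (\<lambda>v. c v + d v)"
  using assms
  by (intro stabilization_topples_rtranclp topples_rtranclp_add topples_stabilization config_add)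

lemma stabilization_add_right:
  assumes "config G s c" "config G s d"
  shows "stab (\<lambda>v. c v + stab d v) = stab (\<lambda>v. c v + d v)"
  using stabilization_add_left[OF assms(2,1)] by (simp add: add.commute)

lemma sandpile_monoid_simps:
  "carrier M = {c. stable G s c}"
  "a \<otimes>\<^bsub>M\<^esub> b = stab (\<lambda>v. a v + b v)"
  "\<one>\<^bsub>M\<^esub> = (\<lambda>_. 0)"
  by (simp_all add: sandpile_monoid_def)

sublocale M: comm_monoid M
proof (rule comm_monoidI, unfold sandpile_monoid_simps mem_Collect_eq)
  fix a b c
  assume "stable G s a" "stable G s b" "stable G s c"
  then have configs: "config G s a" "config G s b" "config G s c"
    by (auto intro: stable_imp_config)
  have "stab (\<lambda>v. stab (\<lambda>v. a v + b v) v + c v) = stab (\<lambda>v. a v + (b v + c v))"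
    using configs stabilization_add_left config_add by (simp add: add.assoc)
  also have "\<dots> = stab (\<lambda>v. a v + stab (\<lambda>v. b v + c v) v)"
    using configs stabilization_add_right config_add by simp
  finally show "stab (\<lambda>v. stab (\<lambda>v. a v + b v) v + c v) =
      stab (\<lambda>v. a v + stab (\<lambda>v. b v + c v) v)" .
qed (auto simp: stable_zero stabilization_stable add.commute
    intro: stable_stabilization config_add stable_imp_config)

lemma stabilization_closed: "config G s c \<Longrightarrow> stab c \<in> carrier M"
  by (simp add: sandpile_monoid_simps stable_stabilization)

lemma stabilization_add:
  assumes "config G s c" "config G s d"
  shows "stab (\<lambda>v. c v + d v) = stab c \<otimes>\<^bsub>M\<^esub> stab d"
  using assms stabilization_add_left stabilization_add_right stable_stabilization
  by (simp add: sandpile_monoid_simps stable_imp_config)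

section \<open>Units of the sandpile monoid\<close>

lemma config_grain: "v \<in> V \<Longrightarrow> config G s (grain v)"
  by (auto simp: config_def grain_def)

lemma config_grain_induct [consumes 1, case_names zero grain]:
  assumes "config G s c" and "P (\<lambda>_. 0)"
    and grain: "\<And>v c. v \<in> V \<Longrightarrow> config G s c \<Longrightarrow> P c \<Longrightarrow> P (\<lambda>w. grain v w + c w)"
  shows "P c"
  using assms(1)
proof (induction "\<Sum>v\<in>V. c v" arbitrary: c)
  case 0
  then have "c = (\<lambda>_. 0)" by (auto simp: config_def)
  then show ?case using assms(2) by simp
next
  case (Suc n)
  then obtain v where "v \<in> V" "0 < c v" by (metis gr0I sum.neutral nat.distinct(1))
  define d where "d = c(v := c v - 1)"
  have c_eq: "c = (\<lambda>w. grain v w + d w)" using \<open>0 < c v\<close> by (auto simp: d_def grain_def)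
  have "(\<Sum>w\<in>V. c w) = (\<Sum>w\<in>V. grain v w) + (\<Sum>w\<in>V. d w)"
    by (subst c_eq) (simp add: sum.distrib)
  then have "n = (\<Sum>w\<in>V. d w)" using Suc.hyps(2) \<open>v \<in> V\<close> by (simp add: grain_def)
  moreover have config_d: "config G s d" using Suc.prems by (auto simp: d_def config_def)
  ultimately have "P d" by (rule Suc.hyps(1))
  with \<open>v \<in> V\<close> config_d have "P (\<lambda>w. grain v w + d w)" by (rule grain)
  then show ?case by (subst c_eq)
qed

lemma stabilization_in_Units_if_grains:
  assumes "config G s c" "\<And>v. 0 < c v \<Longrightarrow> stab (grain v) \<in> Units M"
  shows "stab c \<in> Units M"
  using assms
proof (induction rule: config_grain_induct)
  case zero
  then show ?case
    using M.Units_one_closed by (simp add: stabilization_stable stable_zero sandpile_monoid_simps)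
next
  case (grain v c)
  then have "stab (grain v) \<in> Units M" "stab c \<in> Units M" by (auto simp: grain_def)
  then show ?case using grain.hyps by (simp add: stabilization_add config_grain)
qed

lemma stabilization_grain_in_Units_if_successors:
  assumes "v \<in> V"
    and successors: "\<And>w. w \<in> V \<Longrightarrow> v \<rightarrow>\<^bsub>G\<^esub> w \<Longrightarrow> stab (grain w) \<in> Units M"
  shows "stab (grain v) \<in> Units M"
proof -
  define n where "n = out_degree G v - 1"
  define c where "c = (\<lambda>w. grain v w + n * grain v w)"
  have configs: "config G s (\<lambda>w. n * grain v w)" "config G s c"
    using config_grain[OF \<open>v \<in> V\<close>] by (simp_all add: c_def config_def)
  have c_eq: "c = (\<lambda>w. if w = v then out_degree G v else 0)"
    using out_degree_pos[OF \<open>v \<in> V\<close>] by (auto simp: c_def n_def grain_def)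
  have "stab (topple G s v c) \<in> Units M"
  proof (rule stabilization_in_Units_if_grains)
    fix w assume "0 < topple G s v c w"
    then have "w \<in> V" "0 < card (out_arcs G v \<inter> in_arcs G w)"
      by (auto simp: c_eq topple_def split: if_splits)
    then show "stab (grain w) \<in> Units M"
      using successors unfolding card_arcs_between_pos_iff by blast
  qed (rule config_topple)
  moreover have "topples G s c (topple G s v c)"
    using \<open>v \<in> V\<close> by (auto simp: topples_def c_eq)
  ultimately have "stab c \<in> Units M"
    using stabilization_topples_rtranclp[OF configs(2) r_into_rtranclp] by simp
  moreover have "stab c = stab (grain v) \<otimes>\<^bsub>M\<^esub> stab (\<lambda>w. n * grain v w)"
    unfolding c_def by (rule stabilization_add[OF config_grain[OF \<open>v \<in> V\<close>] configs(1)])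
  ultimately have "stab (grain v) \<otimes>\<^bsub>M\<^esub> stab (\<lambda>w. n * grain v w) \<in> Units M" by simp
  then show ?thesis
    by (rule M.unit_factor) (intro stabilization_closed config_grain \<open>v \<in> V\<close> configs(1))+
qed

lemma topples_rtranclp_keeps_charged:
  assumes "(topples G s)\<^sup>*\<^sup>* c d" "\<exists>v\<in>T. 0 < c v"
    and "T \<subseteq> V" and no_exit: "\<And>v. v \<in> T \<Longrightarrow> \<exists>w\<in>T. v \<rightarrow>\<^bsub>G\<^esub> w"
  shows "\<exists>v\<in>T. 0 < d v"
  using assms(1,2)
proof induction
  case (step c d)
  then obtain v where "v \<in> T" "0 < c v" by blast
  obtain u where d_eq: "d = topple G s u c" using step.hyps(2) by (auto simp: topples_def)
  show ?case
  proof (cases "u = v")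
    case True
    obtain w where "w \<in> T" "v \<rightarrow>\<^bsub>G\<^esub> w" using no_exit \<open>v \<in> T\<close> by blast
    then have "0 < d w"
      using True \<open>T \<subseteq> V\<close> card_arcs_between_pos_iff by (auto simp: d_eq topple_def)
    then show ?thesis using \<open>w \<in> T\<close> by blast
  next
    case False
    then have "0 < d v" using \<open>v \<in> T\<close> \<open>0 < c v\<close> \<open>T \<subseteq> V\<close> by (auto simp: d_eq topple_def)
    then show ?thesis using \<open>v \<in> T\<close> by blast
  qed
qed

section \<open>The sandpile group of \<open>\<S>(0)\<close>\<close>

lemma verts_S_graph_subset: "verts (S_graph G s e) \<subseteq> verts G"
  using S_verts_subset[of s G] sandpile_graph by (simp add: S_graph_def sandpile_graph_def)

lemma config_S_graph_iff:
  "config (S_graph G s e) s c \<longleftrightarrow> config G s c \<and> (\<forall>v. 0 < c v \<longrightarrow> v \<in> verts (S_graph G s e))"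
  using verts_S_graph_subset by (auto simp: config_def)

end

locale sandpile_absorbing = sandpile G s for G :: "('v, 'e) pre_digraph" and s :: 'v +
  assumes out_arcs_sink: "out_arcs G s = {}"
begin

lemma out_degree_S_graph:
  "v \<in> verts (S_graph G s e) \<Longrightarrow> out_degree (S_graph G s e) v = out_degree G v"
  using arcs_S_graph[OF wf_digraph out_arcs_sink]
  by (auto simp: out_degree_def out_arcs_def S_graph_def intro!: arg_cong[of _ _ card])

lemma stable_S_graph_iff:
  "stable (S_graph G s e) s c \<longleftrightarrow> stable G s c \<and> config (S_graph G s e) s c"
proof (cases "config (S_graph G s e) s c")
  case True
  then have outside: "c v < out_degree G v" if "v \<in> V" "v \<notin> verts (S_graph G s e)" for v
    using that out_degree_pos by (simp add: config_def)
  have "(\<forall>v\<in>verts (S_graph G s e) - {s}. c v < out_degree (S_graph G s e) v) \<longleftrightarrow>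
      (\<forall>v\<in>verts (S_graph G s e) - {s}. c v < out_degree G v)"
    by (rule ball_cong) (simp_all add: out_degree_S_graph)
  also have "\<dots> \<longleftrightarrow> (\<forall>v\<in>V. c v < out_degree G v)"
    using outside verts_S_graph_subset by blast
  finally show ?thesis using True by (simp add: stable_def config_S_graph_iff)
qed (simp add: stable_def)

lemma mult_S_graph:
  assumes "config (S_graph G s e) s a" "config (S_graph G s e) s b"
  shows "a \<otimes>\<^bsub>sandpile_monoid (S_graph G s e) s\<^esub> b = a \<otimes>\<^bsub>M\<^esub> b"
proof -
  have "config (S_graph G s e) s (\<lambda>v. a v + b v)" using assms by (simp add: config_def)
  then show ?thesis
    using stabilization_S_graph[OF sandpile_graph out_arcs_sink]
    by (simp add: sandpile_monoid_def)
qed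

abbreviation S :: "('v, 'e) pre_digraph" where
  "S \<equiv> S_graph G s (\<lambda>_. 0)"

abbreviation X :: "('v, 'e) pre_digraph" where
  "X \<equiv> pre_digraph.del_vert G s"

sublocale X: fin_digraph X
  by (rule fin_digraph_del_vert)

lemma verts_S:
  "verts S = {v \<in> V. \<forall>x. v \<rightarrow>\<^sup>*\<^bsub>X\<^esub> x \<longrightarrow> \<not> x \<rightarrow>\<^sup>+\<^bsub>X\<^esub> x} \<union> {s}"
  by (auto simp: S_graph_def S_verts_def Let_def cl_def supp_def X.A_set_zero del_vert_simps)

lemma stabilization_grain_in_Units_if_in_S:
  assumes "v \<in> verts S - {s}"
  shows "stab (grain v) \<in> Units M"
  using X.wf_successors_of_acyclic assms
proof (induction v)
  case (less v)
  then have "v \<in> V" and no_cycle: "v \<rightarrow>\<^sup>*\<^bsub>X\<^esub> x \<Longrightarrow> \<not> x \<rightarrow>\<^sup>+\<^bsub>X\<^esub> x" for x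
    by (auto simp: verts_S)
  show ?case
  proof (rule stabilization_grain_in_Units_if_successors[OF \<open>v \<in> V\<close>])
    fix w assume "w \<in> V" "v \<rightarrow>\<^bsub>G\<^esub> w"
    then have arc: "v \<rightarrow>\<^bsub>X\<^esub> w" using \<open>v \<in> V\<close> by (simp add: dominates_del_vert)
    then have "w \<in> verts S - {s}"
      using no_cycle X.adj_reachable_trans \<open>w \<in> V\<close> by (auto simp: verts_S)
    moreover have "\<not> v \<rightarrow>\<^sup>+\<^bsub>X\<^esub> v" using no_cycle \<open>v \<in> V\<close> by (simp add: del_vert_simps)
    ultimately show "stab (grain w) \<in> Units M" using less.IH arc by simp
  qed
qed

lemma stabilization_in_Units_if_config_S:
  assumes "config S s c"
  shows "stab c \<in> Units M"
proof (rule stabilization_in_Units_if_grains)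
  show "config G s c" using assms by (simp add: config_S_graph_iff)
  fix v assume "0 < c v"
  then have "v \<in> verts S - {s}" using assms by (metis config_def less_irrefl)
  then show "stab (grain v) \<in> Units M" by (rule stabilization_grain_in_Units_if_in_S)
qed

lemma config_S_if_stabilization_zero:
  assumes "config G s c" "stab c = (\<lambda>_. 0)"
  shows "config S s c"
proof (rule ccontr)
  assume "\<not> config S s c"
  let ?T = "V - verts S"
  have "\<exists>v\<in>?T. 0 < stab c v"
  proof (rule topples_rtranclp_keeps_charged)
    show "(topples G s)\<^sup>*\<^sup>* c (stab c)" by (rule topples_stabilization[OF assms(1)])
    obtain v where "0 < c v" "v \<notin> verts S"
      using assms(1) \<open>\<not> config S s c\<close> by (auto simp: config_S_graph_iff)
    moreover from this have "v \<in> V" using assms(1) by (metis config_def less_irrefl)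
    ultimately show "\<exists>v\<in>?T. 0 < c v" by blast
  next
    fix v assume "v \<in> ?T"
    then obtain x where "v \<rightarrow>\<^sup>*\<^bsub>X\<^esub> x" and cyclic: "x \<rightarrow>\<^sup>+\<^bsub>X\<^esub> x" by (auto simp: verts_S)
    then have "v \<rightarrow>\<^sup>+\<^bsub>X\<^esub> x" by (rule X.reachable_reachable1_trans)
    then obtain w where arc: "v \<rightarrow>\<^bsub>X\<^esub> w" and "w \<rightarrow>\<^sup>*\<^bsub>X\<^esub> x"
      by (metis tranclD X.reachable_conv' X.adj_in_verts(2))
    then have "w \<in> ?T" using cyclic X.adj_in_verts by (auto simp: verts_S del_vert_simps)
    then show "\<exists>w\<in>?T. v \<rightarrow>\<^bsub>G\<^esub> w" using arc by (auto simp: dominates_del_vert)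
  qed blast
  then show False using assms(2) by simp
qed

lemma Units_sandpile_monoid: "Units M = {c. stable S s c}"
proof (intro equalityI subsetI)
  fix c assume "c \<in> Units M"
  then obtain d where
    "stable G s c" "stable G s d" "stab (\<lambda>v. c v + d v) = (\<lambda>_. 0)"
    by (auto simp: Units_def sandpile_monoid_simps)
  then have "config S s (\<lambda>v. c v + d v)"
    by (intro config_S_if_stabilization_zero config_add stable_imp_config)
  then show "c \<in> {c. stable S s c}"
    using \<open>stable G s c\<close> by (auto simp: stable_S_graph_iff config_def)
next
  fix c assume "c \<in> {c. stable S s c}"
  then show "c \<in> Units M"
    using stabilization_in_Units_if_config_S[of c]
    by (simp add: stable_S_graph_iff stabilization_stable)
qed

lemma group_sandpile_monoid_S: "group (sandpile_monoid S s)"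
proof -
  let ?N = "sandpile_monoid S s"
  interpret U: group "units_of M" by (rule M.units_group)
  have "a \<otimes>\<^bsub>M\<^esub> b = a \<otimes>\<^bsub>?N\<^esub> b" if "stable S s a" "stable S s b" for a b
    using that by (simp add: mult_S_graph stable_def)
  moreover have "carrier ?N = {c. stable S s c}" by (simp add: sandpile_monoid_def)
  ultimately have "id \<in> iso (units_of M) ?N"
    using U.m_closed
    by (auto simp: iso_def hom_def units_of_carrier units_of_mult Units_sandpile_monoid)
  then have "group (?N\<lparr>one := id \<one>\<^bsub>units_of M\<^esub>\<rparr>)" by (rule U.iso_imp_img_group)
  then show ?thesis by (simp add: units_of_one sandpile_monoid_def)
qed

lemma sandpile_group_S: "sandpile_group S s = {c. stable S s c}"
  using group.minimal_ideal_eq_carrier[OF group_sandpile_monoid_S]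
  by (simp add: sandpile_group_def sandpile_monoid_def)

end

theorem theorem3p5:
  fixes G :: "('v, 'e) pre_digraph" and s :: 'v
  assumes "sandpile_graph G s" and "out_arcs G s = {}"
  shows "(verts (S_graph G s (\<lambda>_. 0)) = {s} \<longrightarrow>
            maximal_subgroup (sandpile_monoid G s) (\<lambda>_. 0) = {\<lambda>_. 0}) \<and>
         (verts (S_graph G s (\<lambda>_. 0)) \<noteq> {s} \<longrightarrow>
            maximal_subgroup (sandpile_monoid G s) (\<lambda>_. 0) = sandpile_group (S_graph G s (\<lambda>_. 0)) s)"
proof -
  interpret sandpile_absorbing G s
    by unfold_locales (fact assms)+
  have "maximal_subgroup M (\<lambda>_. 0) = {c. stable S s c}"
    using M.maximal_subgroup_one Units_sandpile_monoid by (simp add: sandpile_monoid_simps)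
  moreover have "{c. stable S s c} = {\<lambda>_. 0}" if "verts S = {s}"
    using that by (auto simp: stable_def config_def)
  ultimately show ?thesis using sandpile_group_S by simp
qed

end
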